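(* Let $Y_1\ne Y_2$ be rays in $V$, $\varepsilon_1\in Y_1$, $\varepsilon_2\in Y_2$ vectors, and $\alpha_1=q(\varepsilon_1)$, $\alpha_2=q(\varepsilon_2)$, $\alpha_{12}=b(\varepsilon_1,\varepsilon_2)$. For $w\in V$ with $b(\varepsilon_1,w)$, $b(\varepsilon_2,w)$ not both zero, define $u_w\le v_w$ in $[0,\infty]$ by $$u_w=\tfrac{b(\varepsilon_1,w)}{b(\varepsilon_2,w)}\wedge\tfrac{\alpha_1}{\alpha_{12}},\qquad v_w=\tfrac{b(\varepsilon_1,w)}{b(\varepsilon_2,w)}+\tfrac{\alpha_{12}}{\alpha_2}\qquad\text{if }\alpha_1\alpha_2<\alpha_{12}^2,$$ $$u_w=\tfrac{b(\varepsilon_1,w)}{b(\varepsilon_2,w)}\wedge\sqrt{\tfrac{\alpha_1}{\alpha_2}},\qquad v_w=\tfrac{b(\varepsilon_1,w)}{b(\varepsilon_2,w)}+\sqrt{\tfrac{\alpha_1}{\alpha_2}}\qquad\text{if }\alpha_1\alpha_2\ge\alpha_{12}^2.$$ Let $\lambda_0\in[0,\infty]$. Then $\lambda_0$ is unique to the right for $(Y_1,Y_2)$ if there exists some such vector $w$ with $\lambda_0\in[u_w,v_w[$, and $\lambda_0$ is unique to the left for $(Y_1,Y_2)$ if there exists some such vector $w$ with $\lambda_0\in\,]u_w,v_w]$.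
   Context: $R=\{0\}\cup G$ is a bipotent semifield: $G$ is a nontrivial totally ordered abelian group written multiplicatively with unit $e=1$, $0$ is absorbing and smaller than all elements of $G$, and addition is $x+y=\max\{x,y\}$. $R$ is assumed square closed: every element of $R$ has a (unique) square root in $R$. Write $[0,\infty]=R\cup\{\infty\}$ with $x<\infty$ for all $x\in R$; addition extends as maximum. The symbol $\wedge$ means minimum; a quotient $a/0$ with $a\in G$ is read as $\infty$. $V$ is an $R$-module with a quadratic form $q:V\to R$, i.e. $q(\lambda x)=\lambda^2q(x)$, and a symmetric bilinear companion $b:V\times V\to R$, i.e. $q(x+y)=q(x)+q(y)+b(x,y)$ for all $x,y$. It is assumed that $q$ is anisotropic: $q(x)\ne 0$ for $x\neq0$. A ray in $V$ is a class of the equivalence relation on $V\setminus\{0\}$: $x\sim y$ iff $\lambda x=\mu y$ for some $\lambda,\mu\in R\setminus\{0\}$; $\mathrm{ray}(x)$ is the class of $x$. For $\lambda\in[0,\infty]$ consider $\mathrm{ray}(\varepsilon_1+\lambda\varepsilon_2)$, read as $Y_2=\mathrm{ray}(\varepsilon_2)$ for $\lambda=\infty$. The parameter $\lambda_0$ is called unique to the right for $(Y_1,Y_2)$ (with respect to the chosen $\varepsilon_1,\varepsilon_2$) if $\mathrm{ray}(\varepsilon_1+\lambda\varepsilon_2)\ne\mathrm{ray}(\varepsilon_1+\lambda_0\varepsilon_2)$ for all $\lambda>\lambda_0$ in $[0,\infty]$, and unique to the left if this holds for all $\lambda<\lambda_0$. *)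

theory Defs
  imports Main
begin

text \<open>
  A bipotent semifield \<open>R = {0} \<union> G\<close>: the type is \<open>R\<close>, and \<open>G\<close> is the set of its nonzero elements.
  Compatibility of the order with multiplication is not an axiom: it follows from distributivity
  and \<open>x + y = max x y\<close> (see \<open>bipotent_mult_left_mono\<close>).
\<close>

class bipotent_semifield = comm_semiring_1 + linorder + inverse +
  assumes add_eq_max: "x + y = max x y"
    and zero_least: "0 \<le> x"
    and nonzero_right_inverse: "x \<noteq> 0 \<Longrightarrow> x * inverse x = 1"
    and divide_eq_mult_inverse: "x / y = x * inverse y"
    and nontrivial_group: "\<exists>x. x \<noteq> 0 \<and> x \<noteq> 1"
begin

lemma bipotent_mult_left_mono: "x \<le> y \<Longrightarrow> z * x \<le> z * y"
  by (metis add_eq_max distrib_left max.absorb_iff2)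

lemma bipotent_mult_cancel: "z \<noteq> 0 \<Longrightarrow> z * x = z * y \<Longrightarrow> x = y"
  by (metis mult.assoc mult.commute mult_1_right nonzero_right_inverse)

lemma bipotent_mult_left_strict_mono: "z \<noteq> 0 \<Longrightarrow> x < y \<Longrightarrow> z * x < z * y"
  using bipotent_mult_left_mono bipotent_mult_cancel by (metis order.strict_iff_order)

lemma bipotent_square_strict_mono:
  assumes "x < y" shows "x * x < y * y"
proof -
  have "y \<noteq> 0" using assms zero_least by (metis leD)
  have "x * x \<le> x * y" using assms bipotent_mult_left_mono by simp
  also have "\<dots> < y * y"
    using bipotent_mult_left_strict_mono[OF \<open>y \<noteq> 0\<close> assms] by (simp add: mult.commute)
  finally show ?thesis .
qed

end

class square_closed_bipotent_semifield = bipotent_semifield +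
  assumes square_closed: "\<exists>y. y ^ 2 = x"

definition root2 :: "'r::square_closed_bipotent_semifield \<Rightarrow> 'r" where
  "root2 x = (THE y. y ^ 2 = x)"

lemma ex1_root2: "\<exists>!y. y ^ 2 = (x::'r::square_closed_bipotent_semifield)"
proof -
  obtain y where y: "y ^ 2 = x" using square_closed by blast
  moreover have "z = y" if "z ^ 2 = x" for z
  proof (rule ccontr)
    assume "z \<noteq> y"
    then have "z < y \<or> y < z" by (rule neq_iff[THEN iffD1])
    then have "z * z \<noteq> y * y"
      using bipotent_square_strict_mono[of z y] bipotent_square_strict_mono[of y z] by force
    then show False using that y by (simp add: power2_eq_square)
  qed
  ultimately show ?thesis by blast
qed

lemma root2_power2: "root2 x ^ 2 = x"
  unfolding root2_def by (rule theI'[OF ex1_root2])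


text \<open>The ordered set \<open>[0,\<infinity>] = R \<union> {\<infinity>}\<close>.\<close>

datatype 'r upto_infty = Fin 'r | Infty

instantiation upto_infty :: (linorder) linorder
begin

definition less_eq_upto_infty :: "'a upto_infty \<Rightarrow> 'a upto_infty \<Rightarrow> bool" where
  "x \<le> y \<longleftrightarrow> (case y of Infty \<Rightarrow> True
     | Fin t \<Rightarrow> (case x of Infty \<Rightarrow> False | Fin s \<Rightarrow> s \<le> t))"

definition less_upto_infty :: "'a upto_infty \<Rightarrow> 'a upto_infty \<Rightarrow> bool" where
  "x < y \<longleftrightarrow> (case x of Infty \<Rightarrow> False
     | Fin s \<Rightarrow> (case y of Infty \<Rightarrow> True | Fin t \<Rightarrow> s < t))"

instance
proof
  fix x y z :: "'a upto_infty"
  show "x < y \<longleftrightarrow> x \<le> y \<and> \<not> y \<le> x"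
    by (cases x; cases y) (auto simp: less_eq_upto_infty_def less_upto_infty_def)
  show "x \<le> x"
    by (cases x) (auto simp: less_eq_upto_infty_def)
  show "x \<le> y \<Longrightarrow> y \<le> z \<Longrightarrow> x \<le> z"
    by (cases x; cases y; cases z) (auto simp: less_eq_upto_infty_def)
  show "x \<le> y \<Longrightarrow> y \<le> x \<Longrightarrow> x = y"
    by (cases x; cases y) (auto simp: less_eq_upto_infty_def)
  show "x \<le> y \<or> y \<le> x"
    by (cases x; cases y) (auto simp: less_eq_upto_infty_def)
qed

end

instantiation upto_infty :: (linorder) plus
begin

definition "x + y = max x (y :: 'a upto_infty)"

instance ..

end

text \<open>
  The quotient \<open>a / c\<close> in \<open>[0,\<infinity>]\<close>. Only \<open>a / 0\<close> with \<open>a \<noteq> 0\<close> is meaningful as \<open>\<infinity>\<close>; the value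
  at \<open>0 / 0\<close> is a dummy.
\<close>

definition quot :: "'r::bipotent_semifield \<Rightarrow> 'r \<Rightarrow> 'r upto_infty" where
  "quot a c = (if c = 0 then Infty else Fin (a / c))"


text \<open>The library locale \<open>module\<close> requires a ring and an additive group, hence the following.\<close>

locale semimodule =
  fixes scale :: "'r::comm_semiring_1 \<Rightarrow> 'v::comm_monoid_add \<Rightarrow> 'v"
  assumes scale_add_right: "scale a (x + y) = scale a x + scale a y"
    and scale_add_left: "scale (a + c) x = scale a x + scale c x"
    and scale_scale: "scale a (scale c x) = scale (a * c) x"
    and scale_one: "scale 1 x = x"
    and scale_zero_left: "scale 0 x = 0"
    and scale_zero_right: "scale a 0 = 0"

locale symmetric_bilinear_form = semimodule scale
  for scale :: "'r::comm_semiring_1 \<Rightarrow> 'v::comm_monoid_add \<Rightarrow> 'v" +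
  fixes b :: "'v \<Rightarrow> 'v \<Rightarrow> 'r"
  assumes bilin_add_left: "b (x + y) z = b x z + b y z"
    and bilin_scale_left: "b (scale a x) z = a * b x z"
    and bilin_sym: "b x y = b y x"

locale quadratic_pair = symmetric_bilinear_form scale b
  for scale :: "'r::comm_semiring_1 \<Rightarrow> 'v::comm_monoid_add \<Rightarrow> 'v" and b :: "'v \<Rightarrow> 'v \<Rightarrow> 'r" +
  fixes q :: "'v \<Rightarrow> 'r"
  assumes quad_scale: "q (scale a x) = a ^ 2 * q x"
    and quad_add: "q (x + y) = q x + q y + b x y"

locale anisotropic_quadratic_pair = quadratic_pair scale b q
  for scale :: "'r::comm_semiring_1 \<Rightarrow> 'v::comm_monoid_add \<Rightarrow> 'v"
    and b :: "'v \<Rightarrow> 'v \<Rightarrow> 'r" and q :: "'v \<Rightarrow> 'r" +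
  assumes anisotropic: "x \<noteq> 0 \<Longrightarrow> q x \<noteq> 0"


definition ray_rel :: "('r::zero \<Rightarrow> 'v::zero \<Rightarrow> 'v) \<Rightarrow> ('v \<times> 'v) set" where
  "ray_rel scale =
     {(x, y). x \<noteq> 0 \<and> y \<noteq> 0 \<and> (\<exists>s t. s \<noteq> 0 \<and> t \<noteq> 0 \<and> scale s x = scale t y)}"

definition ray :: "('r::zero \<Rightarrow> 'v::zero \<Rightarrow> 'v) \<Rightarrow> 'v \<Rightarrow> 'v set" where
  "ray scale x = ray_rel scale `` {x}"

definition rays :: "('r::zero \<Rightarrow> 'v::zero \<Rightarrow> 'v) \<Rightarrow> 'v set set" where
  "rays scale = (UNIV - {0}) // ray_rel scale"

primrec param_ray ::
  "('r::zero \<Rightarrow> 'v::comm_monoid_add \<Rightarrow> 'v) \<Rightarrow> 'v \<Rightarrow> 'v \<Rightarrow> 'r upto_infty \<Rightarrow> 'v set" where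
  "param_ray scale e1 e2 (Fin l) = ray scale (e1 + scale l e2)"
| "param_ray scale e1 e2 Infty = ray scale e2"

definition unique_to_right ::
  "('r::{zero,linorder} \<Rightarrow> 'v::comm_monoid_add \<Rightarrow> 'v) \<Rightarrow> 'v \<Rightarrow> 'v \<Rightarrow> 'r upto_infty \<Rightarrow> bool" where
  "unique_to_right scale e1 e2 l0 \<longleftrightarrow>
     (\<forall>l>l0. param_ray scale e1 e2 l \<noteq> param_ray scale e1 e2 l0)"

definition unique_to_left ::
  "('r::{zero,linorder} \<Rightarrow> 'v::comm_monoid_add \<Rightarrow> 'v) \<Rightarrow> 'v \<Rightarrow> 'v \<Rightarrow> 'r upto_infty \<Rightarrow> bool" where
  "unique_to_left scale e1 e2 l0 \<longleftrightarrow>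
     (\<forall>l<l0. param_ray scale e1 e2 l \<noteq> param_ray scale e1 e2 l0)"


definition u_bound ::
  "('v \<Rightarrow> 'v \<Rightarrow> 'r::square_closed_bipotent_semifield) \<Rightarrow> ('v \<Rightarrow> 'r)
     \<Rightarrow> 'v \<Rightarrow> 'v \<Rightarrow> 'v \<Rightarrow> 'r upto_infty" where
  "u_bound b q e1 e2 w =
     (if q e1 * q e2 < (b e1 e2) ^ 2
      then min (quot (b e1 w) (b e2 w)) (quot (q e1) (b e1 e2))
      else min (quot (b e1 w) (b e2 w)) (Fin (root2 (q e1 / q e2))))"

definition v_bound ::
  "('v \<Rightarrow> 'v \<Rightarrow> 'r::square_closed_bipotent_semifield) \<Rightarrow> ('v \<Rightarrow> 'r)
     \<Rightarrow> 'v \<Rightarrow> 'v \<Rightarrow> 'v \<Rightarrow> 'r upto_infty" where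
  "v_bound b q e1 e2 w =
     (if q e1 * q e2 < (b e1 e2) ^ 2
      then quot (b e1 w) (b e2 w) + quot (b e1 e2) (q e2)
      else quot (b e1 w) (b e2 w) + Fin (root2 (q e1 / q e2)))"

end

theory Submission
  imports Defs
begin

text \<open>
  Fix \<open>w\<close> and put \<open>\<beta>\<^sub>i = b \<epsilon>\<^sub>i w\<close>. The ratio \<open>b x w ^ 2 / q x\<close> does not change when \<open>x\<close> is multiplied
  by a nonzero scalar, so it is a function of the ray of \<open>x\<close>, and two values of the parameter with
  different ratios give different rays. Along \<open>x = \<epsilon>\<^sub>1 + \<lambda> \<epsilon>\<^sub>2\<close> the ratio is
  \<open>(\<beta>\<^sub>1 + \<lambda> \<beta>\<^sub>2)\<^sup>2 / (\<alpha>\<^sub>1 + \<lambda> \<alpha>\<^sub>12 + \<lambda>\<^sup>2 \<alpha>\<^sub>2)\<close>, in which \<open>+\<close> is the maximum, so on a logarithmic scale both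
  numerator and denominator are piecewise linear. The numerator has slope 0 up to \<open>\<mu> = \<beta>\<^sub>1 / \<beta>\<^sub>2\<close>
  and slope 2 afterwards. The slope of the denominator goes from 0 to 1 at \<open>\<alpha>\<^sub>1 / \<alpha>\<^sub>12\<close> and to 2 at
  \<open>\<alpha>\<^sub>12 / \<alpha>\<^sub>2\<close> if \<open>\<alpha>\<^sub>1 \<alpha>\<^sub>2 < \<alpha>\<^sub>12\<^sup>2\<close>; otherwise the middle term never exceeds the other two and
  the slope jumps from 0 to 2 at the square root of \<open>\<alpha>\<^sub>1 / \<alpha>\<^sub>2\<close>. Hence \<open>u\<^sub>w\<close> and \<open>v\<^sub>w\<close> are the first and the
  last of the breakpoints of numerator and denominator together.

  If \<open>\<mu>\<close> is at or below the first breakpoint of the denominator, the ratio is strictly increasing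
  between \<open>u\<^sub>w\<close> and \<open>v\<^sub>w\<close> and constant outside; if \<open>\<mu>\<close> is at or above its last breakpoint, the ratio
  is strictly decreasing there. If \<open>\<mu>\<close> lies strictly between two distinct breakpoints of the
  denominator, the ratio falls and then rises, so it does not separate the parameters; but then
  \<open>u\<^sub>w = \<alpha>\<^sub>1 / \<alpha>\<^sub>12\<close> and \<open>v\<^sub>w = \<alpha>\<^sub>12 / \<alpha>\<^sub>2\<close>, and the vector \<open>\<epsilon>\<^sub>1\<close> in place of \<open>w\<close> gives an increasing ratio
  on the same interval, because \<open>b \<epsilon>\<^sub>1 \<epsilon>\<^sub>1 \<le> \<alpha>\<^sub>1\<close>.

  In all cases parameters \<open>\<lambda> < \<lambda>'\<close> with \<open>u\<^sub>w < \<lambda>'\<close>, \<open>\<lambda> < v\<^sub>w\<close> and \<open>u\<^sub>w < v\<^sub>w\<close> give different rays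
  (\<open>param_ray_neq\<close>), and both uniqueness statements are instances of this. The calculation is done
  in homogeneous coordinates \<open>(s, t)\<close> of \<open>\<lambda> = t / s\<close>. They include \<open>\<lambda> = \<infinity>\<close> as \<open>(0, 1)\<close>, they
  replace quotients by products, and the exchange of \<open>\<epsilon>\<^sub>1\<close> and \<open>\<epsilon>\<^sub>2\<close> reduces the decreasing case to
  the increasing one (\<open>ratio_increasing\<close>).
\<close>

section \<open>Inequalities in a bipotent semifield\<close>

text \<open>
  These instances make the library's rules for sums, products and powers available. Addition is not
  cancellative, so the classes of strictly ordered semirings do not apply.
\<close>

context bipotent_semifield
begin

subclass canonically_ordered_monoid_add
proof
  show "a \<le> c \<longleftrightarrow> (\<exists>d. c = a + d)" for a c
  proof
    assume "a \<le> c"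
    then have "c = a + c"
      by (simp only: add_eq_max max.absorb2)
    then show "\<exists>d. c = a + d" ..
  next
    assume "\<exists>d. c = a + d"
    then obtain d where "c = max a d"
      unfolding add_eq_max by (elim exE)
    then show "a \<le> c"
      by (simp only: max.cobounded1)
  qed
qed

subclass ordered_comm_semiring
proof
  show "c * x \<le> c * y" if "x \<le> y" for x y c
    using that by (rule bipotent_mult_left_mono)
qed

subclass ordered_semiring_1
proof
  show "0 < 1"
    by (simp only: zero_less_iff_neq_zero one_neq_zero not_False_eq_True)
qed

subclass semiring_1_no_zero_divisors
proof
  show "a * c \<noteq> 0" if "a \<noteq> 0" "c \<noteq> 0" for a c
  proof
    assume "a * c = 0"
    then have "a * c = a * 0"
      by (simp only: mult_zero_right)
    from bipotent_mult_cancel[OF that(1) this] that(2) show False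
      by contradiction
  qed
qed

end

lemma sum_less_iff: "x + y < z \<longleftrightarrow> x < z \<and> y < z" for x :: "'r::bipotent_semifield"
  by (simp add: add_eq_max)

lemma less_sum_iff: "z < x + y \<longleftrightarrow> z < x \<or> z < y" for x :: "'r::bipotent_semifield"
  by (simp add: add_eq_max less_max_iff_disj)

lemma sum_le_iff: "x + y \<le> z \<longleftrightarrow> x \<le> z \<and> y \<le> z" for x :: "'r::bipotent_semifield"
  by (simp add: add_eq_max)

lemma mult_less_left_iff:
  fixes x :: "'r::bipotent_semifield"
  assumes "z \<noteq> 0"
  shows "z * x < z * y \<longleftrightarrow> x < y"
  using bipotent_mult_left_strict_mono[OF assms] bipotent_mult_left_mono
  by (metis leD leI)

lemma mult_less_le_mono:
  fixes a :: "'r::bipotent_semifield"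
  assumes "a < c" "x \<le> y" "y \<noteq> 0"
  shows "a * x < c * y"
proof -
  have "a * x \<le> a * y"
    using assms(2) by (rule bipotent_mult_left_mono)
  also have "\<dots> < c * y"
    using bipotent_mult_left_strict_mono[OF assms(3,1)] by (simp add: mult.commute)
  finally show ?thesis .
qed

lemma square_less_iff: "x\<^sup>2 < y\<^sup>2 \<longleftrightarrow> x < y" for x :: "'r::bipotent_semifield"
proof
  assume "x\<^sup>2 < y\<^sup>2"
  then show "x < y"
    using power_mono[of y x 2] by (meson leI leD zero_le)
qed (simp add: bipotent_square_strict_mono power2_eq_square)

text \<open>Squaring commutes with maxima, as the Frobenius map does with sums.\<close>

lemma square_sum: "(x + y)\<^sup>2 = x\<^sup>2 + y\<^sup>2" for x :: "'r::bipotent_semifield"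
  unfolding add_eq_max using power_mono[of x y 2] power_mono[of y x 2]
  by (cases x y rule: le_cases) (simp_all add: max_absorb1 max_absorb2)



section \<open>Monotonicity of the ratio\<close>

text \<open>
  Here \<open>\<beta>\<^sub>1 + \<lambda> \<beta>\<^sub>2\<close> is the numerator before squaring, and \<open>(s, t)\<close>, \<open>(s', t')\<close> are homogeneous
  coordinates of two parameters in increasing order. The hypotheses \<open>linear\<close> and \<open>quadratic\<close> say
  that the numerator starts to grow no later than the linear term of the denominator overtakes the
  constant one, and strictly before the quadratic term does. By \<open>upper\<close> the larger parameter is
  beyond this point, and by \<open>lower\<close> the smaller one is before the last breakpoint of the
  denominator. The conclusion is the inequality of ratios after clearing denominators. Its left side
  is a maximum of six monomials, and each of them can be bounded separately; all but the last by a
  single monomial on the right.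
\<close>

lemma ratio_increasing:
  fixes \<alpha>1 \<alpha>2 \<alpha>12 \<beta>1 \<beta>2 s t s' t' :: "'r::bipotent_semifield"
  assumes "\<alpha>1 \<noteq> 0"
    and linear: "\<beta>1 * \<alpha>12 \<le> \<alpha>1 * \<beta>2"
    and quadratic: "\<beta>1\<^sup>2 * \<alpha>2 < \<beta>2\<^sup>2 * \<alpha>1"
    and upper: "s' * \<beta>1 < t' * \<beta>2"
    and lower: "t\<^sup>2 * \<alpha>2 < s\<^sup>2 * \<alpha>1 + s * t * \<alpha>12"
    and order: "s' * t < s * t'"
  shows "(s * \<beta>1 + t * \<beta>2)\<^sup>2 * (s'\<^sup>2 * \<alpha>1 + s' * t' * \<alpha>12 + t'\<^sup>2 * \<alpha>2)
    < (s' * \<beta>1 + t' * \<beta>2)\<^sup>2 * (s\<^sup>2 * \<alpha>1 + s * t * \<alpha>12 + t\<^sup>2 * \<alpha>2)"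
proof -
  define D where "D = s\<^sup>2 * \<alpha>1 + s * t * \<alpha>12 + t\<^sup>2 * \<alpha>2"
  define T where "T = t' * \<beta>2"
  have nz: "s \<noteq> 0" "t' \<noteq> 0" "\<beta>2 \<noteq> 0" "T \<noteq> 0"
    using order upper unfolding T_def by auto
  have D: "s\<^sup>2 * \<alpha>1 \<le> D" "s * t * \<alpha>12 \<le> D" "t\<^sup>2 * \<alpha>2 < D"
    using lower by (auto simp: D_def add_eq_max le_max_iff_disj less_max_iff_disj)
  have below1: "x < T\<^sup>2 * D" if "x < T\<^sup>2 * (s\<^sup>2 * \<alpha>1)" for x
    using that bipotent_mult_left_mono[OF D(1), of "T\<^sup>2"] by (rule less_le_trans)
  have below2: "x < T\<^sup>2 * D" if "x < T\<^sup>2 * (s * t * \<alpha>12)" for x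
    using that bipotent_mult_left_mono[OF D(2), of "T\<^sup>2"] by (rule less_le_trans)
  have "(s * \<beta>1)\<^sup>2 * (s'\<^sup>2 * \<alpha>1) < T\<^sup>2 * D"
  proof (rule below1)
    have "(s' * \<beta>1)\<^sup>2 * (s\<^sup>2 * \<alpha>1) < T\<^sup>2 * (s\<^sup>2 * \<alpha>1)"
      using upper nz \<open>\<alpha>1 \<noteq> 0\<close> by - (rule mult_less_le_mono; auto simp: square_less_iff T_def)
    then show "(s * \<beta>1)\<^sup>2 * (s'\<^sup>2 * \<alpha>1) < T\<^sup>2 * (s\<^sup>2 * \<alpha>1)"
      by (simp add: power_mult_distrib ac_simps)
  qed
  moreover have "(s * \<beta>1)\<^sup>2 * (s' * t' * \<alpha>12) < T\<^sup>2 * D"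
  proof (rule below1)
    have "(s' * \<beta>1) * (\<beta>1 * \<alpha>12) < T * (\<alpha>1 * \<beta>2)"
      using upper linear nz \<open>\<alpha>1 \<noteq> 0\<close> by - (rule mult_less_le_mono; auto simp: T_def)
    then have "(s\<^sup>2 * t') * ((s' * \<beta>1) * (\<beta>1 * \<alpha>12)) < (s\<^sup>2 * t') * (T * (\<alpha>1 * \<beta>2))"
      using nz by (simp add: mult_less_left_iff)
    then show "(s * \<beta>1)\<^sup>2 * (s' * t' * \<alpha>12) < T\<^sup>2 * (s\<^sup>2 * \<alpha>1)"
      by (simp add: power2_eq_square T_def ac_simps)
  qed
  moreover have "(s * \<beta>1)\<^sup>2 * (t'\<^sup>2 * \<alpha>2) < T\<^sup>2 * D"
  proof (rule below1)
    have "(s * t')\<^sup>2 * (\<beta>1\<^sup>2 * \<alpha>2) < (s * t')\<^sup>2 * (\<beta>2\<^sup>2 * \<alpha>1)"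
      using quadratic nz by (simp add: mult_less_left_iff)
    then show "(s * \<beta>1)\<^sup>2 * (t'\<^sup>2 * \<alpha>2) < T\<^sup>2 * (s\<^sup>2 * \<alpha>1)"
      by (simp add: power_mult_distrib T_def ac_simps)
  qed
  moreover have "(t * \<beta>2)\<^sup>2 * (s'\<^sup>2 * \<alpha>1) < T\<^sup>2 * D"
  proof (rule below1)
    have "(s' * t)\<^sup>2 * (\<beta>2\<^sup>2 * \<alpha>1) < (s * t')\<^sup>2 * (\<beta>2\<^sup>2 * \<alpha>1)"
      using order nz \<open>\<alpha>1 \<noteq> 0\<close> by - (rule mult_less_le_mono; auto simp: square_less_iff)
    then show "(t * \<beta>2)\<^sup>2 * (s'\<^sup>2 * \<alpha>1) < T\<^sup>2 * (s\<^sup>2 * \<alpha>1)"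
      by (simp add: power_mult_distrib T_def ac_simps)
  qed
  moreover have "(t * \<beta>2)\<^sup>2 * (s' * t' * \<alpha>12) < T\<^sup>2 * D"
  proof (cases "t * \<alpha>12 = 0")
    case True
    then show ?thesis
      using nz \<open>\<alpha>1 \<noteq> 0\<close> by (intro below1) (auto simp: zero_less_iff_neq_zero)
  next
    case False
    have "(s' * t) * (t' * \<beta>2\<^sup>2 * (t * \<alpha>12)) < (s * t') * (t' * \<beta>2\<^sup>2 * (t * \<alpha>12))"
      using order nz False by - (rule mult_less_le_mono; auto)
    then show ?thesis
      by (intro below2) (simp add: power2_eq_square T_def ac_simps)
  qed
  moreover have "(t * \<beta>2)\<^sup>2 * (t'\<^sup>2 * \<alpha>2) < T\<^sup>2 * D"
  proof -
    have "T\<^sup>2 * (t\<^sup>2 * \<alpha>2) < T\<^sup>2 * D"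
      using D(3) nz by (simp add: mult_less_left_iff)
    then show ?thesis
      by (simp add: power_mult_distrib T_def ac_simps)
  qed
  moreover have "s' * \<beta>1 + t' * \<beta>2 = T"
    using upper by (simp add: add_eq_max T_def max_absorb2 less_imp_le)
  ultimately show ?thesis
    unfolding D_def[symmetric] by (simp add: square_sum distrib_left distrib_right sum_less_iff)
qed

text \<open>
  If the denominator has two breakpoints, a numerator that starts to grow no later than at the
  first of them has \<open>\<beta>\<^sub>1\<^sup>2 / \<beta>\<^sub>2\<^sup>2 < \<alpha>\<^sub>1 / \<alpha>\<^sub>2\<close>, because the first breakpoint \<open>\<alpha>\<^sub>1 / \<alpha>\<^sub>12\<close> is smaller than
  the square root of \<open>\<alpha>\<^sub>1 / \<alpha>\<^sub>2\<close>.
\<close>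

lemma ratio_increasing_two_breaks:
  fixes \<alpha>1 \<alpha>2 \<alpha>12 \<beta>1 \<beta>2 s t s' t' :: "'r::bipotent_semifield"
  assumes "\<alpha>1 \<noteq> 0"
    and breaks: "\<alpha>1 * \<alpha>2 < \<alpha>12\<^sup>2"
    and linear: "\<beta>1 * \<alpha>12 \<le> \<alpha>1 * \<beta>2"
    and upper: "s' * \<beta>1 < t' * \<beta>2"
    and lower: "t * \<alpha>2 < s * \<alpha>12"
    and order: "s' * t < s * t'"
  shows "(s * \<beta>1 + t * \<beta>2)\<^sup>2 * (s'\<^sup>2 * \<alpha>1 + s' * t' * \<alpha>12 + t'\<^sup>2 * \<alpha>2)
    < (s' * \<beta>1 + t' * \<beta>2)\<^sup>2 * (s\<^sup>2 * \<alpha>1 + s * t * \<alpha>12 + t\<^sup>2 * \<alpha>2)"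
proof (rule ratio_increasing[OF \<open>\<alpha>1 \<noteq> 0\<close> linear _ upper _ order])
  have nz: "s \<noteq> 0" "\<beta>2 \<noteq> 0"
    using order upper by auto
  show "\<beta>1\<^sup>2 * \<alpha>2 < \<beta>2\<^sup>2 * \<alpha>1"
  proof (cases "\<beta>1 = 0")
    case True
    then show ?thesis
      using nz \<open>\<alpha>1 \<noteq> 0\<close> by (auto simp: zero_less_iff_neq_zero)
  next
    case False
    have "\<alpha>1 * (\<beta>1\<^sup>2 * \<alpha>2) = \<beta>1\<^sup>2 * (\<alpha>1 * \<alpha>2)"
      by (simp add: ac_simps)
    also have "\<dots> < \<beta>1\<^sup>2 * \<alpha>12\<^sup>2"
      using False breaks by (simp add: mult_less_left_iff)
    also have "\<dots> \<le> (\<alpha>1 * \<beta>2)\<^sup>2"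
      using power_mono[OF linear zero_le, of 2] by (simp add: power_mult_distrib)
    also have "\<dots> = \<alpha>1 * (\<beta>2\<^sup>2 * \<alpha>1)"
      by (simp add: power2_eq_square ac_simps)
    finally show ?thesis
      using \<open>\<alpha>1 \<noteq> 0\<close> by (simp add: mult_less_left_iff)
  qed
  show "t\<^sup>2 * \<alpha>2 < s\<^sup>2 * \<alpha>1 + s * t * \<alpha>12"
  proof (cases "t = 0")
    case True
    then show ?thesis
      using nz \<open>\<alpha>1 \<noteq> 0\<close> by (auto simp: zero_less_iff_neq_zero)
  next
    case False
    then have "t * (t * \<alpha>2) < t * (s * \<alpha>12)"
      using lower by (simp add: mult_less_left_iff)
    then show ?thesis
      by (simp add: less_sum_iff power2_eq_square ac_simps)
  qed
qed

text \<open>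
  If the denominator has a single breakpoint, \<open>\<beta>\<^sub>1\<^sup>2 / \<beta>\<^sub>2\<^sup>2 < \<alpha>\<^sub>1 / \<alpha>\<^sub>2\<close> conversely bounds
  \<open>\<beta>\<^sub>1 / \<beta>\<^sub>2\<close> by \<open>\<alpha>\<^sub>1 / \<alpha>\<^sub>12\<close>, since now \<open>\<alpha>\<^sub>12\<^sup>2 \<le> \<alpha>\<^sub>1 \<alpha>\<^sub>2\<close>.
\<close>

lemma ratio_increasing_one_break:
  fixes \<alpha>1 \<alpha>2 \<alpha>12 \<beta>1 \<beta>2 s t s' t' :: "'r::bipotent_semifield"
  assumes "\<alpha>1 \<noteq> 0"
    and break: "\<alpha>12\<^sup>2 \<le> \<alpha>1 * \<alpha>2"
    and quadratic: "\<beta>1\<^sup>2 * \<alpha>2 < \<beta>2\<^sup>2 * \<alpha>1"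
    and upper: "s' * \<beta>1 < t' * \<beta>2"
    and lower: "t\<^sup>2 * \<alpha>2 < s\<^sup>2 * \<alpha>1"
    and order: "s' * t < s * t'"
  shows "(s * \<beta>1 + t * \<beta>2)\<^sup>2 * (s'\<^sup>2 * \<alpha>1 + s' * t' * \<alpha>12 + t'\<^sup>2 * \<alpha>2)
    < (s' * \<beta>1 + t' * \<beta>2)\<^sup>2 * (s\<^sup>2 * \<alpha>1 + s * t * \<alpha>12 + t\<^sup>2 * \<alpha>2)"
proof (rule ratio_increasing[OF \<open>\<alpha>1 \<noteq> 0\<close> _ quadratic upper _ order])
  have "(\<beta>1 * \<alpha>12)\<^sup>2 \<le> \<beta>1\<^sup>2 * (\<alpha>1 * \<alpha>2)"
    using bipotent_mult_left_mono[OF break, of "\<beta>1\<^sup>2"] by (simp add: power_mult_distrib)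
  also have "\<dots> = \<alpha>1 * (\<beta>1\<^sup>2 * \<alpha>2)"
    by (simp add: ac_simps)
  also have "\<dots> \<le> \<alpha>1 * (\<beta>2\<^sup>2 * \<alpha>1)"
    using quadratic by (intro bipotent_mult_left_mono less_imp_le)
  also have "\<dots> = (\<alpha>1 * \<beta>2)\<^sup>2"
    by (simp add: power2_eq_square ac_simps)
  finally show "\<beta>1 * \<alpha>12 \<le> \<alpha>1 * \<beta>2"
    using square_less_iff[of "\<alpha>1 * \<beta>2" "\<beta>1 * \<alpha>12"] by (simp add: not_less[symmetric])
  show "t\<^sup>2 * \<alpha>2 < s\<^sup>2 * \<alpha>1 + s * t * \<alpha>12"
    using lower by (simp add: less_sum_iff)
qed


section \<open>Homogeneous coordinates on the parameter interval\<close>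

primrec coord1 :: "'r::zero_neq_one upto_infty \<Rightarrow> 'r" where
  "coord1 (Fin l) = 1"
| "coord1 Infty = 0"

primrec coord2 :: "'r::zero_neq_one upto_infty \<Rightarrow> 'r" where
  "coord2 (Fin l) = l"
| "coord2 Infty = 1"

lemma less_upto_infty_simps [simp]:
  "Fin x < Fin y \<longleftrightarrow> x < y" "Fin x < Infty" "\<not> Infty < l"
  by (auto simp: less_upto_infty_def split: upto_infty.splits)

lemma coord_less_iff: "l < m \<longleftrightarrow> coord1 m * coord2 l < coord1 l * coord2 m"
  for l m :: "'r::bipotent_semifield upto_infty"
  by (cases l; cases m) (auto simp: zero_less_iff_neq_zero)

lemma mult_divide_self:
  fixes a c :: "'r::bipotent_semifield"
  assumes "c \<noteq> 0"
  shows "c * (a / c) = a"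
proof -
  have "c * (a / c) = a * (c * inverse c)"
    by (simp add: divide_eq_mult_inverse ac_simps)
  then show ?thesis
    using nonzero_right_inverse[OF assms] by simp
qed

lemma quot_less_iff: "quot a c < l \<longleftrightarrow> coord1 l * a < coord2 l * c"
  for a c :: "'r::bipotent_semifield"
proof (cases "c = 0")
  case False
  then have "a / c < x \<longleftrightarrow> a < x * c" for x
    using mult_less_left_iff[OF False, of "a / c" x]
    by (simp only: mult_divide_self[OF False] mult.commute[of x])
  with False show ?thesis
    by (cases l) (auto simp: quot_def zero_less_iff_neq_zero)
qed (simp add: quot_def)

lemma less_quot_iff:
  fixes a c :: "'r::bipotent_semifield"
  assumes "a \<noteq> 0 \<or> c \<noteq> 0"
  shows "l < quot a c \<longleftrightarrow> coord2 l * c < coord1 l * a"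
proof (cases "c = 0")
  case True
  with assms show ?thesis
    by (cases l) (auto simp: quot_def zero_less_iff_neq_zero)
next
  case False
  then have "x < a / c \<longleftrightarrow> x * c < a" for x
    using mult_less_left_iff[OF False, of x "a / c"]
    by (simp only: mult_divide_self[OF False] mult.commute[of x])
  with False show ?thesis
    by (cases l) (auto simp: quot_def)
qed

lemma quot_less_quot_iff:
  fixes a c :: "'r::bipotent_semifield"
  assumes "a' \<noteq> 0 \<or> c' \<noteq> 0"
  shows "quot a c < quot a' c' \<longleftrightarrow> c' * a < a' * c"
proof (cases "c' = 0")
  case True
  then show ?thesis
    using assms by (auto simp: quot_def zero_less_iff_neq_zero)
next
  case False
  have "quot a c < quot a' c' \<longleftrightarrow> a < (a' / c') * c"
    using False by (simp add: quot_def[of a'] quot_less_iff)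
  also have "\<dots> \<longleftrightarrow> c' * a < c' * (a' / c') * c"
    using mult_less_left_iff[OF False, of a "(a' / c') * c"] by (simp only: mult.assoc)
  finally show ?thesis
    by (simp only: mult_divide_self[OF False])
qed

lemma mult_root_square:
  fixes a c :: "'r::square_closed_bipotent_semifield"
  assumes "c \<noteq> 0"
  shows "c * (y * root2 (a / c))\<^sup>2 = y\<^sup>2 * a"
  by (simp only: power_mult_distrib root2_power2 mult.left_commute[of c] mult_divide_self[OF assms])

lemma mult_root_less_iff:
  fixes a c :: "'r::square_closed_bipotent_semifield"
  assumes "c \<noteq> 0"
  shows "y * root2 (a / c) < x \<longleftrightarrow> y\<^sup>2 * a < x\<^sup>2 * c"
  using mult_less_left_iff[OF assms, of "(y * root2 (a / c))\<^sup>2" "x\<^sup>2"] mult_root_square[OF assms, of y a]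
  by (simp add: square_less_iff mult.commute)

lemma less_mult_root_iff:
  fixes a c :: "'r::square_closed_bipotent_semifield"
  assumes "c \<noteq> 0"
  shows "x < y * root2 (a / c) \<longleftrightarrow> x\<^sup>2 * c < y\<^sup>2 * a"
  using mult_less_left_iff[OF assms, of "x\<^sup>2" "(y * root2 (a / c))\<^sup>2"] mult_root_square[OF assms, of y a]
  by (simp add: square_less_iff mult.commute)

lemma root_less_iff:
  fixes a c :: "'r::square_closed_bipotent_semifield"
  assumes "c \<noteq> 0"
  shows "Fin (root2 (a / c)) < l \<longleftrightarrow> (coord1 l)\<^sup>2 * a < (coord2 l)\<^sup>2 * c"
  using mult_root_less_iff[OF assms] by (simp add: coord_less_iff)

lemma less_root_iff:
  fixes a c :: "'r::square_closed_bipotent_semifield"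
  assumes "c \<noteq> 0"
  shows "l < Fin (root2 (a / c)) \<longleftrightarrow> (coord2 l)\<^sup>2 * c < (coord1 l)\<^sup>2 * a"
  using less_mult_root_iff[OF assms] by (simp add: coord_less_iff)

lemma quot_less_root_iff:
  fixes a c :: "'r::square_closed_bipotent_semifield"
  assumes "c \<noteq> 0"
  shows "quot x y < Fin (root2 (a / c)) \<longleftrightarrow> x\<^sup>2 * c < y\<^sup>2 * a"
  using less_mult_root_iff[OF assms] by (simp add: quot_less_iff mult.commute)

lemma root_less_quot_iff:
  fixes a c :: "'r::square_closed_bipotent_semifield"
  assumes "c \<noteq> 0" "x \<noteq> 0 \<or> y \<noteq> 0"
  shows "Fin (root2 (a / c)) < quot x y \<longleftrightarrow> y\<^sup>2 * a < x\<^sup>2 * c"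
  using mult_root_less_iff[OF assms(1)] by (simp add: less_quot_iff[OF assms(2)] mult.commute)


section \<open>Distinct rays\<close>

lemma nonzero_of_mem_rays: "Y \<in> rays scale \<Longrightarrow> x \<in> Y \<Longrightarrow> x \<noteq> 0"
  by (auto simp: rays_def quotient_def ray_rel_def)

lemma (in semimodule) proportional_of_ray_eq:
  assumes "ray scale x = ray scale y" "y \<noteq> 0"
  shows "\<exists>c d. c \<noteq> 0 \<and> d \<noteq> 0 \<and> scale c x = scale d y"
proof -
  have "\<exists>c d. c \<noteq> 0 \<and> d \<noteq> 0 \<and> scale c y = scale d y"
    using one_neq_zero by blast
  then have "y \<in> ray scale y"
    using assms(2) by (simp add: ray_def ray_rel_def)
  then have "y \<in> ray scale x"
    using assms(1) by simp
  then show ?thesis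
    by (simp add: ray_def ray_rel_def)
qed

text \<open>
  This makes \<open>b x w ^ 2 / q x\<close> an invariant of the ray of \<open>x\<close>: a scalar factor of \<open>x\<close> enters both
  \<open>b x w ^ 2\<close> and \<open>q x\<close> as its square.
\<close>

lemma ratio_eq_of_ray_eq:
  fixes scale :: "'r::bipotent_semifield \<Rightarrow> 'v::comm_monoid_add \<Rightarrow> 'v"
  assumes "quadratic_pair scale b q"
    and "ray scale x = ray scale y" "y \<noteq> 0"
  shows "(b x w)\<^sup>2 * q y = (b y w)\<^sup>2 * q x"
proof -
  interpret quadratic_pair scale b q by fact
  obtain c d where nz: "c \<noteq> 0" "d \<noteq> 0" and eq: "scale c x = scale d y"
    using proportional_of_ray_eq[OF assms(2,3)] by blast
  have "c * b x w = d * b y w"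
    using arg_cong[OF eq, of "\<lambda>z. b z w"] by (simp add: bilin_scale_left)
  moreover have "c\<^sup>2 * q x = d\<^sup>2 * q y"
    using arg_cong[OF eq, of q] by (simp add: quad_scale)
  ultimately have "(c * b x w)\<^sup>2 * (d\<^sup>2 * q y) = (d * b y w)\<^sup>2 * (c\<^sup>2 * q x)"
    by simp
  then have "(c * d)\<^sup>2 * ((b x w)\<^sup>2 * q y) = (c * d)\<^sup>2 * ((b y w)\<^sup>2 * q x)"
    by (simp add: power_mult_distrib ac_simps)
  moreover have "(c * d)\<^sup>2 \<noteq> 0"
    using nz by simp
  ultimately show ?thesis
    by (rule bipotent_mult_cancel[rotated])
qed

text \<open>
  A sum of two copies of \<open>x\<close> is \<open>x\<close>, since \<open>1 + 1 = 1\<close>; so the companion cannot exceed the form on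
  the diagonal.
\<close>

lemma companion_diagonal_le:
  fixes scale :: "'r::bipotent_semifield \<Rightarrow> 'v::comm_monoid_add \<Rightarrow> 'v"
  assumes "quadratic_pair scale b q"
  shows "b x x \<le> q x"
proof -
  interpret quadratic_pair scale b q by fact
  have "x + x = x"
    using scale_add_left[of 1 1 x] by (simp only: scale_one add_eq_max[of 1 1] max.idem)
  then have "q x + q x + b x x = q x"
    using quad_add[of x x] by simp
  then show ?thesis
    using sum_le_iff[of "q x + q x" "b x x" "q x"] by simp
qed

text \<open>
  The hypothesis compares the ratios at \<open>l\<close> and \<open>m\<close> after clearing denominators. It is a mere
  disequality because the ratio increases for some choices of \<open>w\<close> and decreases for others.
\<close>

lemma param_ray_neq_of_ratio_neq:
  fixes scale :: "'r::bipotent_semifield \<Rightarrow> 'v::comm_monoid_add \<Rightarrow> 'v"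
  assumes pair: "quadratic_pair scale b q"
    and "q e1 \<noteq> 0" "q e2 \<noteq> 0"
    and neq: "(coord1 l * b e1 w + coord2 l * b e2 w)\<^sup>2 *
        ((coord1 m)\<^sup>2 * q e1 + coord1 m * coord2 m * b e1 e2 + (coord2 m)\<^sup>2 * q e2) \<noteq>
      (coord1 m * b e1 w + coord2 m * b e2 w)\<^sup>2 *
        ((coord1 l)\<^sup>2 * q e1 + coord1 l * coord2 l * b e1 e2 + (coord2 l)\<^sup>2 * q e2)"
  shows "param_ray scale e1 e2 l \<noteq> param_ray scale e1 e2 m"
proof
  interpret quadratic_pair scale b q by fact
  define vec where "vec l = scale (coord1 l) e1 + scale (coord2 l) e2" for l
  assume "param_ray scale e1 e2 l = param_ray scale e1 e2 m"
  moreover have "param_ray scale e1 e2 k = ray scale (vec k)" for k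
    by (cases k) (simp_all add: vec_def scale_one scale_zero_left)
  ultimately have rays: "ray scale (vec l) = ray scale (vec m)"
    by simp
  have b_vec: "b (vec k) w = coord1 k * b e1 w + coord2 k * b e2 w" for k
    by (simp add: vec_def bilin_add_left bilin_scale_left)
  have b_scaled: "b (scale c e1) (scale d e2) = c * d * b e1 e2" for c d
    using bilin_scale_left[of c e1 "scale d e2"] bilin_scale_left[of d e2 e1] bilin_sym
    by (metis mult.assoc)
  have q_vec: "q (vec k) =
      (coord1 k)\<^sup>2 * q e1 + coord1 k * coord2 k * b e1 e2 + (coord2 k)\<^sup>2 * q e2" for k
    by (simp add: vec_def quad_add quad_scale b_scaled ac_simps)
  have "q (vec m) \<noteq> 0"
    unfolding q_vec using assms(2,3) by (cases m) auto
  moreover have "q 0 = 0"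
    using quad_scale[of 0 0] by (simp add: scale_zero_right)
  ultimately have "vec m \<noteq> 0"
    by auto
  from ratio_eq_of_ray_eq[OF pair rays this, of w] neq show False
    by (simp only: b_vec q_vec)
qed

text \<open>
  Both kinds of uniqueness are instances of this. If \<open>\<lambda>\<^sub>0 \<in> [u, v[\<close>, take \<open>\<lambda>\<^sub>0\<close> for the smaller
  parameter, and if \<open>\<lambda>\<^sub>0 \<in> ]u, v]\<close>, take it for the larger one. The hypothesis \<open>u < v\<close> excludes the
  case of a single breakpoint that is common to numerator and denominator, where the ratio is constant.
\<close>

lemma param_ray_neq:
  fixes scale :: "'r::square_closed_bipotent_semifield \<Rightarrow> 'v::comm_monoid_add \<Rightarrow> 'v"
  assumes pair: "quadratic_pair scale b q"
    and nz: "q e1 \<noteq> 0" "q e2 \<noteq> 0"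
    and w: "b e1 w \<noteq> 0 \<or> b e2 w \<noteq> 0"
    and u: "u_bound b q e1 e2 w < m"
    and v: "l < v_bound b q e1 e2 w"
    and uv: "u_bound b q e1 e2 w < v_bound b q e1 e2 w"
    and "l < m"
  shows "param_ray scale e1 e2 l \<noteq> param_ray scale e1 e2 m"
proof -
  note distinct = param_ray_neq_of_ratio_neq[OF pair nz]
  let ?mu = "quot (b e1 w) (b e2 w)"
  have order: "coord1 m * coord2 l < coord1 l * coord2 m"
    using \<open>l < m\<close> by (simp add: coord_less_iff)
  \<comment> \<open>The order condition in the form required after the exchange of the two vectors.\<close>
  have order': "coord2 l * coord1 m < coord2 m * coord1 l"
    using order by (simp add: mult.commute)
  show ?thesis
  proof (cases "q e1 * q e2 < (b e1 e2)\<^sup>2")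
    case True
    let ?p = "quot (q e1) (b e1 e2)" and ?r = "quot (b e1 e2) (q e2)"
    have breaks': "q e2 * q e1 < (b e1 e2)\<^sup>2"
      using True by (simp add: mult.commute)
    have u: "min ?mu ?p < m" and v: "l < max ?mu ?r"
      using u v True by (simp_all add: u_bound_def v_bound_def plus_upto_infty_def)
    have "\<not> ?r < ?p"
      using True nz quot_less_quot_iff[of "q e1" "b e1 e2" "b e1 e2" "q e2"]
      by (auto simp: power2_eq_square)
    consider "?mu \<le> ?p" | "?r \<le> ?mu" | "?p < ?mu" "?mu < ?r"
      by fastforce
    then show ?thesis
    proof cases
      case 1
      have "?mu < m"
        using u 1 by (simp add: min_def)
      moreover have "l < ?r"
        using v 1 \<open>\<not> ?r < ?p\<close> by (auto simp: max_def split: if_splits)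
      moreover have "b e1 w * b e1 e2 \<le> q e1 * b e2 w"
        using 1 w nz quot_less_quot_iff[OF w, of "q e1" "b e1 e2"]
        by (simp add: not_less[symmetric] mult.commute)
      ultimately show ?thesis
        using ratio_increasing_two_breaks[OF nz(1) True, of "b e1 w" "b e2 w"
            "coord1 m" "coord2 m" "coord2 l" "coord1 l"] order nz
        by (intro distinct[of _ w] less_imp_neq) (simp add: quot_less_iff less_quot_iff)
    next
      case 2
      \<comment> \<open>The ratio decreases in \<open>\<lambda>\<close>, hence increases in the inverse parameter \<open>s / t\<close>.\<close>
      have "?p < m"
        using u 2 \<open>\<not> ?r < ?p\<close> by (auto simp: min_def split: if_splits)
      moreover have "l < ?mu"
        using v 2 by (simp add: max_def split: if_splits)
      moreover have "b e2 w * b e1 e2 \<le> q e2 * b e1 w"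
        using 2 nz quot_less_quot_iff[of "b e1 e2" "q e2" "b e1 w" "b e2 w"]
        by (simp add: not_less[symmetric] mult.commute)
      ultimately have "(coord2 m * b e2 w + coord1 m * b e1 w)\<^sup>2 *
          ((coord2 l)\<^sup>2 * q e2 + coord2 l * coord1 l * b e1 e2 + (coord1 l)\<^sup>2 * q e1)
        < (coord2 l * b e2 w + coord1 l * b e1 w)\<^sup>2 *
          ((coord2 m)\<^sup>2 * q e2 + coord2 m * coord1 m * b e1 e2 + (coord1 m)\<^sup>2 * q e1)"
        using order' w by (intro ratio_increasing_two_breaks[OF nz(2) breaks'])
          (simp_all add: quot_less_iff less_quot_iff)
      then show ?thesis
        by (intro distinct[of _ w] less_imp_neq[symmetric]) (simp add: ac_simps)
    next
      case 3
      \<comment> \<open>Here \<open>w\<close> does not separate the rays, and \<open>e1\<close> takes its place.\<close>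
      have "?p < m" "l < ?r"
        using u v 3 by (auto simp: min_def max_def split: if_splits)
      then have upper: "coord1 m * q e1 < coord2 m * b e1 e2"
        and lower: "coord2 l * q e2 < coord1 l * b e1 e2"
        using nz by (simp_all add: quot_less_iff less_quot_iff)
      interpret quadratic_pair scale b q by fact
      have diag: "b e1 e1 \<le> q e1"
        by (rule companion_diagonal_le[OF pair])
      have sym: "b e2 e1 = b e1 e2"
        by (rule bilin_sym)
      have "coord1 m * b e1 e1 < coord2 m * b e1 e2"
        using bipotent_mult_left_mono[OF diag, of "coord1 m"] upper by (rule le_less_trans)
      moreover have "b e1 e1 * b e1 e2 \<le> q e1 * b e1 e2"
        using diag by (rule mult_right_mono) simp
      ultimately show ?thesis
        using ratio_increasing_two_breaks[OF nz(1) True _ _ lower order, of "b e1 e1" "b e1 e2"]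
        by (intro distinct[of _ e1] less_imp_neq) (simp add: sym)
    qed
  next
    case False
    let ?s = "Fin (root2 (q e1 / q e2))"
    have break: "(b e1 e2)\<^sup>2 \<le> q e1 * q e2" and break': "(b e1 e2)\<^sup>2 \<le> q e2 * q e1"
      using False by (simp_all add: mult.commute)
    have u: "min ?mu ?s < m" and v: "l < max ?mu ?s" and uv: "min ?mu ?s < max ?mu ?s"
      using u v uv False by (simp_all add: u_bound_def v_bound_def plus_upto_infty_def)
    from uv consider "?mu < ?s" | "?s < ?mu"
      by (cases ?mu ?s rule: linorder_cases) auto
    then show ?thesis
    proof cases
      case 1
      then have "?mu < m" "l < ?s"
        using u v by (auto simp: min_def max_def split: if_splits)
      moreover have "(b e1 w)\<^sup>2 * q e2 < (b e2 w)\<^sup>2 * q e1"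
        using 1 by (simp only: quot_less_root_iff[OF nz(2)])
      ultimately show ?thesis
        using ratio_increasing_one_break[OF nz(1) break, of "b e1 w" "b e2 w"
            "coord1 m" "coord2 m" "coord2 l" "coord1 l"] order nz
        by (intro distinct[of _ w] less_imp_neq) (simp add: quot_less_iff less_root_iff)
    next
      case 2
      then have "?s < m" "l < ?mu"
        using u v by (auto simp: min_def max_def split: if_splits)
      moreover have "(b e2 w)\<^sup>2 * q e1 < (b e1 w)\<^sup>2 * q e2"
        using 2 by (simp only: root_less_quot_iff[OF nz(2) w])
      ultimately have "(coord2 m * b e2 w + coord1 m * b e1 w)\<^sup>2 *
          ((coord2 l)\<^sup>2 * q e2 + coord2 l * coord1 l * b e1 e2 + (coord1 l)\<^sup>2 * q e1)
        < (coord2 l * b e2 w + coord1 l * b e1 w)\<^sup>2 *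
          ((coord2 m)\<^sup>2 * q e2 + coord2 m * coord1 m * b e1 e2 + (coord1 m)\<^sup>2 * q e1)"
        using order' w nz by (intro ratio_increasing_one_break[OF nz(2) break'])
          (simp_all add: less_quot_iff root_less_iff)
      then show ?thesis
        by (intro distinct[of _ w] less_imp_neq[symmetric]) (simp add: ac_simps)
    qed
  qed
qed

theorem theorem1p7:
  fixes scale :: "'r::square_closed_bipotent_semifield \<Rightarrow> 'v::comm_monoid_add \<Rightarrow> 'v"
    and b :: "'v \<Rightarrow> 'v \<Rightarrow> 'r"
    and q :: "'v \<Rightarrow> 'r"
    and Y1 Y2 :: "'v set"
    and \<epsilon>1 \<epsilon>2 :: 'v
    and l0 :: "'r upto_infty"
  assumes "anisotropic_quadratic_pair scale b q"
    and "Y1 \<in> rays scale" and "Y2 \<in> rays scale" and "Y1 \<noteq> Y2"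
    and "\<epsilon>1 \<in> Y1" and "\<epsilon>2 \<in> Y2"
  shows "((\<exists>w. (b \<epsilon>1 w \<noteq> 0 \<or> b \<epsilon>2 w \<noteq> 0)
               \<and> l0 \<in> {u_bound b q \<epsilon>1 \<epsilon>2 w ..< v_bound b q \<epsilon>1 \<epsilon>2 w})
            \<longrightarrow> unique_to_right scale \<epsilon>1 \<epsilon>2 l0)
       \<and> ((\<exists>w. (b \<epsilon>1 w \<noteq> 0 \<or> b \<epsilon>2 w \<noteq> 0)
               \<and> l0 \<in> {u_bound b q \<epsilon>1 \<epsilon>2 w <.. v_bound b q \<epsilon>1 \<epsilon>2 w})
            \<longrightarrow> unique_to_left scale \<epsilon>1 \<epsilon>2 l0)"
proof -
  interpret anisotropic_quadratic_pair scale b q by fact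
  have pair: "quadratic_pair scale b q"
    by (rule quadratic_pair_axioms)
  have nz: "q \<epsilon>1 \<noteq> 0" "q \<epsilon>2 \<noteq> 0"
    using nonzero_of_mem_rays[OF assms(2,5)] nonzero_of_mem_rays[OF assms(3,6)] anisotropic
    by blast+
  note neq = param_ray_neq[OF pair nz]
  show ?thesis
  proof (intro conjI impI; elim exE conjE)
    fix w
    assume w: "b \<epsilon>1 w \<noteq> 0 \<or> b \<epsilon>2 w \<noteq> 0"
      and "l0 \<in> {u_bound b q \<epsilon>1 \<epsilon>2 w ..< v_bound b q \<epsilon>1 \<epsilon>2 w}"
    then have u: "u_bound b q \<epsilon>1 \<epsilon>2 w \<le> l0" and v: "l0 < v_bound b q \<epsilon>1 \<epsilon>2 w"
      by simp_all
    show "unique_to_right scale \<epsilon>1 \<epsilon>2 l0"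
      unfolding unique_to_right_def
    proof (intro allI impI)
      fix l
      assume "l0 < l"
      with u have "u_bound b q \<epsilon>1 \<epsilon>2 w < l"
        by (rule le_less_trans)
      from neq[OF w this v le_less_trans[OF u v] \<open>l0 < l\<close>]
      show "param_ray scale \<epsilon>1 \<epsilon>2 l \<noteq> param_ray scale \<epsilon>1 \<epsilon>2 l0"
        by (rule not_sym)
    qed
  next
    fix w
    assume w: "b \<epsilon>1 w \<noteq> 0 \<or> b \<epsilon>2 w \<noteq> 0"
      and "l0 \<in> {u_bound b q \<epsilon>1 \<epsilon>2 w <.. v_bound b q \<epsilon>1 \<epsilon>2 w}"
    then have u: "u_bound b q \<epsilon>1 \<epsilon>2 w < l0" and v: "l0 \<le> v_bound b q \<epsilon>1 \<epsilon>2 w"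
      by simp_all
    show "unique_to_left scale \<epsilon>1 \<epsilon>2 l0"
      unfolding unique_to_left_def
    proof (intro allI impI)
      fix l
      assume "l < l0"
      then have "l < v_bound b q \<epsilon>1 \<epsilon>2 w"
        using v by (rule less_le_trans)
      from neq[OF w u this less_le_trans[OF u v] \<open>l < l0\<close>]
      show "param_ray scale \<epsilon>1 \<epsilon>2 l \<noteq> param_ray scale \<epsilon>1 \<epsilon>2 l0" .
    qed
  qed
qed

end
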